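(* Let $p$ be a nonzero trim self-inversive polynomial of darga $n$, written as $p(x)=\sum_{j=1}^{\lfloor n/2\rfloor}\sigma_j(x^j+x^{n-j})+i\sum_{j=1}^{\lfloor (n-1)/2\rfloor}\hat p_j(x^j-x^{n-j})$ with real $\sigma_j,\hat p_j$. Then (a) $\mathrm{il}(p)=\tfrac12\max\{-p(\omega):\omega\in U_n\}$; (b) $\mathrm{il}(p)=\max_{0\le j<n}-\Big(\sum_{k=1}^{\lfloor n/2\rfloor}\cos\frac{2\pi jk}{n}\,\sigma_k+\sum_{k=1}^{\lfloor (n-1)/2\rfloor}\sin\frac{2\pi jk}{n}\,\hat p_k\Big)$.
   Context: For a nonzero polynomial $p(x)=\sum_{j=r}^{s}p_jx^j$ with $p_r,p_s\neq 0$, its darga is $r+s$. A complex polynomial of darga $n$ is self-inversive if $p_j=\overline{p_{n-j}}$ for all $j$; it is trim if $p(0)=0$. Every trim self-inversive polynomial of darga $n$ has a unique representation as in the claim with real coefficients. Let $U_n$ be the set of $n$-th roots of unity. For real $\alpha$ put $p_\alpha(x)=\alpha(x^n+1)+p(x)$. A degree-$n$ polynomial strictly angle-interlaces $U_n$ if the arguments in $[0,2\pi)$ of its $n$ roots (with multiplicity) and of the points of $U_n$ are $2n$ distinct numbers alternating when sorted. The interlace number is $\mathrm{il}(p)=\inf\{\alpha>0:p_\alpha\text{ strictly angle-interlaces }U_n\}$. *)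

theory Defs
  imports
    "HOL-Analysis.Analysis"
    "HOL-Computational_Algebra.Computational_Algebra"
    "HOL-Library.Extended_Real"
begin

definition darga :: "complex poly \<Rightarrow> nat" where
  "darga p = (LEAST r. coeff p r \<noteq> 0) + degree p"

definition self_inversive :: "complex poly \<Rightarrow> bool" where
  "self_inversive p \<longleftrightarrow> (\<forall>j \<le> darga p. coeff p j = cnj (coeff p (darga p - j)))"

definition trim :: "complex poly \<Rightarrow> bool" where
  "trim p \<longleftrightarrow> poly p 0 = 0"

definition unity_roots :: "nat \<Rightarrow> complex set" where
  "unity_roots n = {z. z ^ n = 1}"

definition p_alpha :: "nat \<Rightarrow> complex poly \<Rightarrow> real \<Rightarrow> complex poly" where
  "p_alpha n p \<alpha> = smult (complex_of_real \<alpha>) (monom 1 n + 1) + p"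

definition root_angles :: "complex poly \<Rightarrow> real multiset" where
  "root_angles q = image_mset Arg2pi (proots q)"

definition unity_angles :: "nat \<Rightarrow> real multiset" where
  "unity_angles n = image_mset Arg2pi (mset_set (unity_roots n))"

(* Since Arg2pi 0 = 0 = Arg2pi 1, a polynomial with root 0 is rejected by
   distinctness of the list, so the convention for the argument of 0 is harmless. *)
definition strictly_angle_interlaces :: "complex poly \<Rightarrow> nat \<Rightarrow> bool" where
  "strictly_angle_interlaces q n \<longleftrightarrow>
     degree q = n \<and>
     (let xs = sorted_list_of_multiset (root_angles q + unity_angles n)
      in length xs = 2 * n \<and> distinct xs \<and>
         (\<forall>i. Suc i < length xs \<longrightarrow>
            (xs ! i \<in># root_angles q \<and> xs ! Suc i \<in># unity_angles n) \<or>
            (xs ! i \<in># unity_angles n \<and> xs ! Suc i \<in># root_angles q)))"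

(* Extended reals, so that the infimum of the empty set is infinity rather than
   an unspecified real number. *)
definition interlace_number :: "complex poly \<Rightarrow> ereal" where
  "interlace_number p =
     (INF \<alpha> \<in> {\<alpha>. 0 < \<alpha> \<and> strictly_angle_interlaces (p_alpha (darga p) p \<alpha>) (darga p)}.
        ereal \<alpha>)"

end

theory Submission
  imports Defs
begin

text \<open>
  A self-inversive \<open>q\<close> of darga \<open>n\<close> becomes the real function \<open>f t = cis (- n t / 2) * q (cis t)\<close> on the
  unit circle, and at the \<open>k\<close>-th node \<open>f\<close> has the sign \<open>(- 1) ^ k\<close> times that of \<open>q\<close>.
  If \<open>q\<close> is positive on the \<open>n\<close>-th roots of unity, \<open>f\<close> therefore changes sign on each of the \<open>n\<close> arcs,
  which accounts for all \<open>n\<close> roots. Conversely, if the roots interlace, they are symmetric under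
  \<open>z \<mapsto> 1 / cnj z\<close> and have distinct angles \<open>\<theta> m\<close>, hence lie on the circle, and \<open>f\<close> is a constant times
  \<open>\<Prod>m<n. sin ((t - \<theta> m) / 2)\<close>, so \<open>q\<close> has one and the same sign at all roots of unity; for \<open>p\<^sub>\<alpha>\<close> this sign is
  positive because \<open>p\<close> sums to \<open>0\<close> over the roots of unity. So \<open>p\<^sub>\<alpha>\<close> interlaces iff
  \<open>2 \<alpha> + p \<omega> > 0\<close> for all \<open>\<omega>\<close>.
\<close>

section \<open>Roots of unity and their angles\<close>

abbreviation unity_angle :: "nat \<Rightarrow> nat \<Rightarrow> real" where
  "unity_angle n k \<equiv> 2 * pi * real k / real n"

lemma unity_roots_eq:
  assumes "n > 0"
  shows "unity_roots n = (\<lambda>k. cis (unity_angle n k)) ` {..<n}"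
  using Complex.bij_betw_roots_unity[OF assms] by (auto simp: bij_betw_def unity_roots_def)

lemma unity_angle_bounds:
  assumes "k < n"
  shows "0 \<le> unity_angle n k" "unity_angle n k < 2 * pi"
  using assms by (auto simp: field_simps)

lemma Arg2pi_cis:
  assumes "0 \<le> t" "t < 2 * pi"
  shows "Arg2pi (cis t) = t"
  using assms Arg2pi_unique[of 1 t "cis t"] by (simp add: cis_conv_exp)

lemma unity_angles_eq:
  assumes "n > 0"
  shows "unity_angles n = mset (map (unity_angle n) [0..<n])"
proof -
  have inj: "inj_on (\<lambda>k. cis (unity_angle n k)) {..<n}"
    using Complex.bij_betw_roots_unity[OF assms] by (simp add: bij_betw_def)
  have "unity_angles n = image_mset Arg2pi (image_mset (\<lambda>k. cis (unity_angle n k)) (mset_set {..<n}))"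
    unfolding unity_angles_def unity_roots_eq[OF assms] by (simp add: image_mset_mset_set[OF inj])
  also have "\<dots> = image_mset (unity_angle n) (mset_set {..<n})"
    by (simp add: multiset.map_comp o_def, rule image_mset_cong)
       (use unity_angle_bounds in \<open>auto intro!: Arg2pi_cis\<close>)
  finally show ?thesis
    by (simp add: atLeast0LessThan[symmetric])
qed

section \<open>Interlacing as one root angle per arc\<close>

text \<open>Distinctness makes \<open>A\<close> disjoint from the values of \<open>t\<close>, so a
  first entry from \<open>t\<close> and the alternation force values of \<open>t\<close> at even
  positions and elements of \<open>A\<close> at odd ones. The even entries form a strictly
  increasing list with the same elements as \<open>t\<close>, hence they are \<open>t\<close> in
  order; the odd entries serve as \<open>u\<close>.\<close>

lemma alternating_sorted_list_decompose:
  fixes xs :: "'a :: linorder list"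
  assumes "sorted xs" "distinct xs" "length xs = 2 * n"
    and mset: "mset xs = A + mset (map t [0..<n])"
    and t: "strict_mono_on {..<n} t"
    and first: "n > 0 \<Longrightarrow> xs ! 0 \<in> t ` {..<n}"
    and alt: "\<And>i. Suc i < length xs \<Longrightarrow>
            (xs ! i \<in># A \<and> xs ! Suc i \<in> t ` {..<n}) \<or> (xs ! i \<in> t ` {..<n} \<and> xs ! Suc i \<in># A)"
  obtains u where "A = mset (map u [0..<n])" "\<And>k. k < n \<Longrightarrow> t k < u k"
    "\<And>k. Suc k < n \<Longrightarrow> u k < t (Suc k)"
proof -
  have less: "xs ! i < xs ! j" if "i < j" "j < 2 * n" for i j
    using assms(1-3) that by (metis sorted_wrt_nth_less strict_sorted_iff)
  have cnt: "count A x + count (mset (map t [0..<n])) x \<le> 1" for x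
    using \<open>distinct xs\<close> mset by (metis count_union distinct_count_atmost_1 order_refl zero_le)
  have disj: "False" if "x \<in># A" "x \<in> t ` {..<n}" for x
  proof -
    have "x \<in># mset (map t [0..<n])" using that(2) by auto
    then have "count (mset (map t [0..<n])) x \<ge> 1" "count A x \<ge> 1"
      using that(1) by (simp_all only: count_greater_eq_one_iff)
    then show False using cnt[of x] by linarith
  qed
  have par: "(even i \<longrightarrow> xs ! i \<in> t ` {..<n}) \<and> (odd i \<longrightarrow> xs ! i \<in># A)" if "i < 2 * n" for i
    using that
  proof (induction i)
    case 0
    then show ?case using first by simp
  next
    case (Suc i)
    then show ?case using alt[of i] disj[of "xs ! i"] assms(3) by auto
  qed
  have set: "set xs = set_mset A \<union> t ` {..<n}"
    using arg_cong[OF mset, of set_mset] by (auto simp: atLeast0LessThan)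
  define ts where "ts = map (\<lambda>m. xs ! (2 * m)) [0..<n]"
  have "sorted_wrt (<) ts"
    unfolding ts_def sorted_wrt_map by (rule sorted_wrt_mono_rel[OF _ sorted_wrt_upt]) (auto intro: less)
  moreover have "sorted_wrt (<) (map t [0..<n])"
    unfolding sorted_wrt_map
    by (rule sorted_wrt_mono_rel[OF _ sorted_wrt_upt]) (use t in \<open>auto simp: strict_mono_on_def\<close>)
  moreover have "set ts = set (map t [0..<n])"
  proof (intro equalityI subsetI)
    fix x assume "x \<in> set ts"
    then obtain m where "m < n" "x = xs ! (2 * m)" by (auto simp: ts_def)
    then show "x \<in> set (map t [0..<n])" using par[of "2 * m"] by (auto simp: atLeast0LessThan)
  next
    fix x assume "x \<in> set (map t [0..<n])"
    then have x: "x \<in> t ` {..<n}" by auto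
    then obtain i where i: "i < 2 * n" "x = xs ! i"
      using set assms(3) by (metis UnI2 in_set_conv_nth)
    then have "even i" using par[of i] disj[of x] x by auto
    then show "x \<in> set ts" using i by (auto simp: ts_def elim!: evenE)
  qed
  ultimately have "ts = map t [0..<n]"
    by (intro sorted_distinct_set_unique) (auto simp: strict_sorted_iff)
  then have ev: "xs ! (2 * k) = t k" if "k < n" for k
    using that by (auto simp: ts_def dest: arg_cong[of _ _ "\<lambda>l. l ! k"])
  define u where "u k = xs ! Suc (2 * k)" for k
  have "A = mset (map u [0..<n])"
  proof (rule multiset_eqI)
    fix x
    have "sorted_wrt (<) (map u [0..<n])"
      unfolding sorted_wrt_map u_def
      by (rule sorted_wrt_mono_rel[OF _ sorted_wrt_upt]) (auto intro: less)
    then have d: "distinct (map u [0..<n])" by (simp only: strict_sorted_iff)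
    have "x \<in># A \<longleftrightarrow> x \<in> set (map u [0..<n])"
    proof
      assume x: "x \<in># A"
      then obtain i where i: "i < 2 * n" "x = xs ! i"
        using set assms(3) by (metis UnI1 in_set_conv_nth)
      then have "odd i" using par[of i] disj[of x] x by auto
      then show "x \<in> set (map u [0..<n])" using i by (auto simp: u_def elim!: oddE)
    next
      assume "x \<in> set (map u [0..<n])"
      then obtain m where "m < n" "x = xs ! Suc (2 * m)" by (auto simp: u_def)
      then show "x \<in># A" using par[of "Suc (2 * m)"] by auto
    qed
    moreover have "count A x \<le> 1" using cnt[of x] by linarith
    ultimately show "count A x = count (mset (map u [0..<n])) x"
      unfolding distinct_count_atmost_1[THEN iffD1, OF d, rule_format]
      by (cases "x \<in># A") (auto simp: not_in_iff le_antisym Suc_leI)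
  qed
  moreover have "t k < u k" if "k < n" for k
    using less[of "2 * k" "Suc (2 * k)"] ev[of k] that by (simp add: u_def)
  moreover have "u k < t (Suc k)" if "Suc k < n" for k
    using less[of "Suc (2 * k)" "2 * Suc k"] ev[of "Suc k"] that by (simp add: u_def)
  ultimately show thesis using that by blast
qed

text \<open>Serves the converse of the decomposition: the inequalities make the explicit merge
  strictly increasing, so it must be the sorted list.\<close>

lemma sorted_list_of_multiset_interleave:
  fixes t u :: "nat \<Rightarrow> 'a :: linorder"
  assumes "\<And>k. k < n \<Longrightarrow> t k < u k" "\<And>k. Suc k < n \<Longrightarrow> u k < t (Suc k)"
  shows "sorted_list_of_multiset (mset (map u [0..<n]) + mset (map t [0..<n]))
         = map (\<lambda>i. if even i then t (i div 2) else u (i div 2)) [0..<2 * n]" (is "_ = ?xs")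
    and "distinct (map (\<lambda>i. if even i then t (i div 2) else u (i div 2)) [0..<2 * n])"
proof -
  have mset_eq: "mset ?xs = mset (map u [0..<n]) + mset (map t [0..<n])"
    by (induction n) auto
  have "sorted_wrt (<) ?xs"
  proof (subst sorted_wrt_iff_nth_Suc_transp)
    show "\<forall>i. Suc i < length ?xs \<longrightarrow> ?xs ! i < ?xs ! Suc i"
    proof (intro allI impI)
      fix i assume i: "Suc i < length ?xs"
      show "?xs ! i < ?xs ! Suc i"
      proof (cases "even i")
        case True
        then show ?thesis using i assms(1)[of "i div 2"] by auto
      next
        case False
        then have "Suc (i div 2) < n" using i by simp presburger
        then show ?thesis using i False assms(2)[of "i div 2"] by auto
      qed
    qed
  qed simp
  then show "distinct ?xs" "sorted_list_of_multiset (mset (map u [0..<n]) + mset (map t [0..<n])) = ?xs"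
    unfolding mset_eq[symmetric] strict_sorted_iff
    by (auto simp only: sorted_list_of_multiset_mset sort_key_id_if_sorted sorted_sort_id)
qed

text \<open>Alternation could start with either kind of angle. Since \<open>1\<close> is a root of
  unity with the least possible angle \<open>0\<close>, it starts with a unity angle, which puts the
  \<open>k\<close>-th root angle into the \<open>k\<close>-th arc. The last arc ends at
  \<open>2 * pi\<close>, a bound that \<open>Arg2pi\<close> supplies by itself.\<close>

lemma strictly_angle_interlaces_iff:
  assumes "n > 0"
  shows "strictly_angle_interlaces q n \<longleftrightarrow> degree q = n \<and>
    (\<exists>\<theta>. root_angles q = mset (map \<theta> [0..<n]) \<and>
      (\<forall>k<n. unity_angle n k < \<theta> k) \<and> (\<forall>k. Suc k < n \<longrightarrow> \<theta> k < unity_angle n (Suc k)))"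
    (is "_ \<longleftrightarrow> _ \<and> ?R")
proof -
  let ?T = "mset (map (unity_angle n) [0..<n])"
  let ?xs = "sorted_list_of_multiset (root_angles q + ?T)"
  have memT: "x \<in># ?T \<longleftrightarrow> x \<in> unity_angle n ` {..<n}" for x by auto
  have mono: "strict_mono_on {..<n} (unity_angle n)"
    using assms by (auto simp: strict_mono_on_def divide_strict_right_mono)
  have "?R" if *: "length ?xs = 2 * n" "distinct ?xs"
    "\<forall>i. Suc i < length ?xs \<longrightarrow>
            (?xs ! i \<in># root_angles q \<and> ?xs ! Suc i \<in># ?T) \<or>
            (?xs ! i \<in># ?T \<and> ?xs ! Suc i \<in># root_angles q)"
  proof -
    have "?xs ! 0 \<in> unity_angle n ` {..<n}"
    proof -
      have "0 \<in> unity_angle n ` {..<n}" using assms by force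
      then have "0 \<in> set ?xs" by (auto simp: atLeast0LessThan)
      then obtain j where j: "j < length ?xs" "?xs ! j = 0" by (metis in_set_conv_nth)
      then have "?xs ! 0 \<le> 0" by (metis sorted_nth_mono sorted_sorted_list_of_multiset zero_le)
      moreover have "?xs ! 0 \<in> set ?xs" using *(1) assms by (intro nth_mem) auto
      then have "?xs ! 0 \<ge> 0"
        using unity_angle_bounds(1)[of _ n] Arg2pi_ge_0 by (auto simp: root_angles_def)
      ultimately show ?thesis using \<open>0 \<in> unity_angle n ` {..<n}\<close> by simp
    qed
    then obtain u where "root_angles q = mset (map u [0..<n])"
        "\<And>k. k < n \<Longrightarrow> unity_angle n k < u k" "\<And>k. Suc k < n \<Longrightarrow> u k < unity_angle n (Suc k)"
      using alternating_sorted_list_decompose[of ?xs n "root_angles q" "unity_angle n"] *(3)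
      unfolding memT
      by (metis *(1,2) mono mset_sorted_list_of_multiset sorted_sorted_list_of_multiset)
    then show ?R by blast
  qed
  moreover have "length ?xs = 2 * n \<and> distinct ?xs \<and> (\<forall>i. Suc i < length ?xs \<longrightarrow>
            (?xs ! i \<in># root_angles q \<and> ?xs ! Suc i \<in># ?T) \<or>
            (?xs ! i \<in># ?T \<and> ?xs ! Suc i \<in># root_angles q))" if ?R
  proof -
    obtain \<theta> where \<theta>: "root_angles q = mset (map \<theta> [0..<n])"
      "\<And>k. k < n \<Longrightarrow> unity_angle n k < \<theta> k" "\<And>k. Suc k < n \<Longrightarrow> \<theta> k < unity_angle n (Suc k)"
      using \<open>?R\<close> by blast
    note sl = sorted_list_of_multiset_interleave[of n "unity_angle n" \<theta>, OF \<theta>(2,3)]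
    let ?ys = "map (\<lambda>i. if even i then unity_angle n (i div 2) else \<theta> (i div 2)) [0..<2 * n]"
    have nth: "?ys ! i
        \<in># (if even i then ?T else mset (map \<theta> [0..<n]))" if "i < 2 * n" for i
      using that by auto
    have "(?ys ! i \<in># mset (map \<theta> [0..<n]) \<and> ?ys ! Suc i \<in># ?T) \<or>
          (?ys ! i \<in># ?T \<and> ?ys ! Suc i \<in># mset (map \<theta> [0..<n]))" if "Suc i < 2 * n" for i
      using nth[OF that] nth[of i] that
      by (cases "even i") (simp_all only: even_Suc if_True if_False not_True_eq_False not_False_eq_True simp_thms Suc_lessD)
    moreover have "?xs = ?ys" "length ?ys = 2 * n"
      using sl(1) \<theta>(1) by simp_all
    ultimately show ?thesis
      using sl(2) unfolding \<theta>(1)[symmetric] by (simp only: simp_thms) blast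
  qed
  ultimately show ?thesis
    unfolding strictly_angle_interlaces_def unity_angles_eq[OF assms] Let_def by blast
qed

section \<open>Symmetry under reflection in the unit circle\<close>

text \<open>Reindexing by \<open>n - j\<close> trades each coefficient for its conjugate partner. It
  follows that \<open>z \<mapsto> 1 / cnj z\<close> sends nonzero roots to roots.\<close>

lemma poly_reciprocal_cnj:
  assumes "degree q \<le> n" and coeff: "\<And>j. j \<le> n \<Longrightarrow> coeff q j = cnj (coeff q (n - j))" and "z \<noteq> 0"
  shows "poly q z = z ^ n * cnj (poly q (1 / cnj z))"
proof -
  have expand: "poly q x = (\<Sum>j\<le>n. coeff q j * x ^ j)" for x
    by (subst poly_as_sum_of_monoms'[OF assms(1), symmetric]) (simp add: poly_sum poly_monom)
  have "poly q z = (\<Sum>j\<le>n. cnj (coeff q (n - j)) * z ^ j)"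
    unfolding expand by (rule sum.cong[OF refl]) (simp only: coeff[symmetric] atMost_iff)
  also have "\<dots> = (\<Sum>j\<le>n. cnj (coeff q j) * z ^ (n - j))"
    by (rule sum.reindex_bij_witness[of _ "\<lambda>j. n - j" "\<lambda>j. n - j"]) auto
  also have "\<dots> = (\<Sum>j\<le>n. z ^ n * (cnj (coeff q j) * (1 / z) ^ j))"
    by (rule sum.cong) (use \<open>z \<noteq> 0\<close> in \<open>auto simp: power_diff power_divide\<close>)
  also have "\<dots> = z ^ n * cnj (poly q (1 / cnj z))"
    unfolding expand by (simp add: sum_distrib_left)
  finally show ?thesis .
qed

text \<open>The reflection fixes the circle pointwise, so \<open>poly q (cis t)\<close> is
  \<open>cis (n * t)\<close> times its own conjugate; undoing half of that phase makes the value
  self-conjugate.\<close>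

lemma poly_cis_half_turn_real:
  assumes "degree q \<le> n" and coeff: "\<And>j. j \<le> n \<Longrightarrow> coeff q j = cnj (coeff q (n - j))"
  shows "cis (- (real n * t / 2)) * poly q (cis t) \<in> \<real>"
proof -
  have "1 / cnj (cis t) = cis t"
    by (simp add: cis_cnj divide_inverse)
  then have "poly q (cis t) = cis (real n * t) * cnj (poly q (cis t))"
    using poly_reciprocal_cnj[OF assms, of "cis t"] by (simp add: Complex.DeMoivre)
  then have "cis (- (real n * t / 2)) * poly q (cis t)
             = cis (- (real n * t / 2)) * cis (real n * t) * cnj (poly q (cis t))"
    by (metis mult.assoc)
  also have "\<dots> = cnj (cis (- (real n * t / 2)) * poly q (cis t))"
    by (simp add: cis_mult cis_cnj) (simp add: mult.commute)
  finally show ?thesis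
    using Reals_cnj_iff by metis
qed

section \<open>Positivity at the nodes implies interlacing\<close>

lemma cis_unity_angle_mem:
  assumes "n > 0"
  shows "cis (unity_angle n k) \<in> unity_roots n"
proof -
  have "cis (unity_angle n k) ^ n = cis (2 * pi * real k)"
    using assms by (simp add: Complex.DeMoivre)
  also have "\<dots> = 1"
    by (rule cis_multiple_2pi) auto
  finally show ?thesis by (simp add: unity_roots_def)
qed

lemma cis_pi_of_nat: "cis (pi * real k) = (- 1) ^ k"
  using Complex.DeMoivre[of pi k] by (simp add: mult.commute)

lemma interlaces_if_positive_on_unity_roots:
  assumes n: "n > 0" and deg: "degree q = n"
    and coeff: "\<And>j. j \<le> n \<Longrightarrow> coeff q j = cnj (coeff q (n - j))"
    and pos: "\<And>\<omega>. \<omega> \<in> unity_roots n \<Longrightarrow> Re (poly q \<omega>) > 0"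
  shows "strictly_angle_interlaces q n"
proof -
  define f where "f t = Re (cis (- (real n * t / 2)) * poly q (cis t))" for t
  have cont: "continuous_on A f" for A
    unfolding f_def by (intro continuous_intros) auto
  have root: "poly q (cis t) = 0" if "f t = 0" for t
  proof -
    \<comment> \<open>\<open>f\<close> records only a real part, but the rotated value is real, so
      nothing is lost.\<close>
    have "cis (- (real n * t / 2)) * poly q (cis t) = 0"
      using poly_cis_half_turn_real[OF eq_refl[OF deg] coeff, of t] that
      by (auto simp: f_def complex_is_Real_iff complex_eq_iff simp del: cis.sel)
    then show ?thesis by simp
  qed
  \<comment> \<open>The half-turn factor at the node is \<open>cis (- (pi * k)) = (- 1) ^ k\<close>,
    so \<open>f\<close> alternates in sign from node to node.\<close>
  have f_node: "(- 1) ^ k * f (unity_angle n k) > 0" for k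
  proof -
    have "- (real n * unity_angle n k / 2) = - (pi * real k)"
      using n by simp
    then have "cis (- (real n * unity_angle n k / 2)) = of_real ((- 1) ^ k)"
      by (metis cis_pi_of_nat cis_inverse inverse_minus_eq inverse_1 of_real_1 of_real_minus of_real_power power_inverse)
    then have "f (unity_angle n k) = (- 1) ^ k * Re (poly q (cis (unity_angle n k)))"
      unfolding f_def by (simp only: Re_complex_of_real Im_complex_of_real times_complex.sel)
    then have "(- 1) ^ k * f (unity_angle n k) = Re (poly q (cis (unity_angle n k)))"
      by (simp flip: power_mult_distrib mult.assoc)
    then show ?thesis using pos[OF cis_unity_angle_mem[OF n]] by simp
  qed
  have "\<exists>t. unity_angle n k < t \<and> t < unity_angle n (Suc k) \<and> f t = 0" for k
  proof -
    \<comment> \<open>The factor \<open>(- 1) ^ k\<close> turns both parities into a passage from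
      positive to negative, so one form of the intermediate value theorem suffices.\<close>
    have "(- 1) ^ k * f (unity_angle n (Suc k)) < 0"
      using f_node[of "Suc k"] by simp
    moreover have "unity_angle n k \<le> unity_angle n (Suc k)"
      using n by (simp add: field_simps)
    ultimately obtain t where t: "unity_angle n k \<le> t" "t \<le> unity_angle n (Suc k)" "(- 1) ^ k * f t = 0"
      using IVT2'[of "\<lambda>t. (- 1) ^ k * f t" "unity_angle n (Suc k)" 0 "unity_angle n k"] f_node[of k]
      by (force intro!: continuous_intros cont)
    then have ft: "f t = 0" by simp
    then have "t \<noteq> unity_angle n k" "t \<noteq> unity_angle n (Suc k)"
      using f_node[of k] f_node[of "Suc k"] by fastforce+
    then show ?thesis using t ft by (intro exI[of _ t]) linarith
  qed
  then obtain \<theta> where \<theta>: "\<And>k. unity_angle n k < \<theta> k" "\<And>k. \<theta> k < unity_angle n (Suc k)"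
    "\<And>k. f (\<theta> k) = 0"
    by metis
  have Arg: "Arg2pi (cis (\<theta> k)) = \<theta> k" if "k < n" for k
  proof (rule Arg2pi_cis)
    show "0 \<le> \<theta> k" using \<theta>(1)[of k] unity_angle_bounds(1)[OF that] by linarith
    \<comment> \<open>The last arc, \<open>k = n - 1\<close>, ends exactly at \<open>2 * pi\<close>,
      so the angle does not wrap around.\<close>
    have "unity_angle n (Suc k) \<le> 2 * pi"
      using mult_left_mono[of "real (Suc k)" "real n" "2 * pi"] that by (simp add: divide_le_eq)
    then show "\<theta> k < 2 * pi" using \<theta>(2)[of k] by linarith
  qed
  have "strict_mono \<theta>"
    unfolding strict_mono_Suc_iff using \<theta>(1,2) less_trans by blast
  then have inj: "inj_on (\<lambda>k. cis (\<theta> k)) {..<n}"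
    by (intro inj_onI) (metis Arg lessThan_iff strict_mono_eq)
  have "q \<noteq> 0" using deg n by auto
  \<comment> \<open>The \<open>n\<close> distinct zeros form a submultiset of the \<open>n\<close>
    roots counted with multiplicity; equal sizes force equality, so no root is missed or
    repeated.\<close>
  have "mset_set ((\<lambda>k. cis (\<theta> k)) ` {..<n}) \<subseteq># proots q"
    using \<open>q \<noteq> 0\<close> root \<theta>(3)
    by (auto simp: subseteq_mset_def count_mset_set' order_root Suc_le_eq)
  moreover have "size (proots q) = size (mset_set ((\<lambda>k. cis (\<theta> k)) ` {..<n}))"
    using card_image[OF inj] deg by (simp add: size_proots_complex)
  ultimately have "proots q = mset_set ((\<lambda>k. cis (\<theta> k)) ` {..<n})"
    by (metis less_irrefl mset_subset_size subset_mset.le_imp_less_or_eq)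
  also have "\<dots> = image_mset (\<lambda>k. cis (\<theta> k)) (mset_set {..<n})"
    by (rule image_mset_mset_set[OF inj, symmetric])
  finally have "root_angles q = image_mset \<theta> (mset_set {..<n})"
    unfolding root_angles_def
    by (simp add: multiset.map_comp o_def) (rule image_mset_cong, use Arg in auto)
  then have "root_angles q = mset (map \<theta> [0..<n])"
    by (simp add: atLeast0LessThan[symmetric])
  then show ?thesis
    unfolding strictly_angle_interlaces_iff[OF n] using deg \<theta>(1,2) by blast
qed

section \<open>Interlacing implies a common sign at the nodes\<close>

text \<open>Half-angle formula for a chord, with the phases in \<open>s\<close> and \<open>t\<close>
  separated: in a product over roots \<open>cis s\<close>, the \<open>s\<close>-phases form a
  constant and the \<open>t\<close>-phases a power of \<open>cis (t / 2)\<close>.\<close>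

lemma cis_diff_eq: "cis t - cis s = 2 * \<i> * cis (s / 2) * cis (t / 2) * of_real (sin ((t - s) / 2))"
proof -
  have sin_eq: "2 * \<i> * of_real (sin u) = cis u - cis (- u)" for u
    by (simp add: complex_eq_iff)
  have "2 * \<i> * cis (s / 2) * cis (t / 2) * of_real (sin ((t - s) / 2))
      = cis (s / 2) * cis (t / 2) * (cis ((t - s) / 2) - cis (- ((t - s) / 2)))"
    unfolding sin_eq[symmetric] by (simp only: mult_ac)
  also have "\<dots> = cis t - cis s"
    by (simp add: right_diff_distrib cis_mult) (simp add: field_simps)
  finally show ?thesis by simp
qed

lemma sin_half_diff_pos:
  fixes a b :: real
  assumes "0 \<le> b" "b < a" "a < 2 * pi"
  shows "0 < sin ((a - b) / 2)"
  using assms by (intro sin_gt_zero) auto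

text \<open>Replacing \<open>q\<close> by its negative keeps the roots and the symmetry, so
  interlacing can only give one common sign at the nodes; \<open>sum_pos\<close> decides which
  one.\<close>

lemma positive_on_unity_roots_if_interlaces:
  assumes n: "n > 0"
    and coeff: "\<And>j. j \<le> n \<Longrightarrow> coeff q j = cnj (coeff q (n - j))"
    and inter: "strictly_angle_interlaces q n"
    and sum_pos: "(\<Sum>\<omega>\<in>unity_roots n. Re (poly q \<omega>)) > 0"
    and "\<omega> \<in> unity_roots n"
  shows "Re (poly q \<omega>) > 0"
proof -
  from inter obtain \<theta> where deg: "degree q = n"
    and angles: "root_angles q = mset (map \<theta> [0..<n])"
    and lower: "\<And>k. k < n \<Longrightarrow> unity_angle n k < \<theta> k"
    and upper: "\<And>k. Suc k < n \<Longrightarrow> \<theta> k < unity_angle n (Suc k)"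
    unfolding strictly_angle_interlaces_iff[OF n] by blast
  have "q \<noteq> 0" using deg n by auto
  have node_mono: "unity_angle n i \<le> unity_angle n j" if "i \<le> j" for i j
    using that by (simp add: divide_right_mono)
  have bounds: "0 \<le> \<theta> m" "\<theta> m < 2 * pi" if "m < n" for m
  proof -
    have "\<theta> m \<in># root_angles q" using that by (simp add: angles)
    then show "0 \<le> \<theta> m" "\<theta> m < 2 * pi"
      by (auto simp: root_angles_def Arg2pi_ge_0 Arg2pi_lt_2pi)
  qed
  have \<theta>_mono: "\<theta> i < \<theta> j" if "i < j" "j < n" for i j
    using that upper[of i] node_mono[of "Suc i" j] lower[of j] by linarith
  then have "distinct (map \<theta> [0..<n])"
    unfolding distinct_map by (auto simp: inj_on_def) (metis less_irrefl nat_neq_iff)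
  then have count_le: "count (root_angles q) x \<le> 1" for x
    by (simp add: angles distinct_count_atmost_1 del: mset_map)
  \<comment> \<open>Two distinct roots of equal angle would give that angle multiplicity
    two.\<close>
  have inj: "z = z'" if z: "z \<in># proots q" "z' \<in># proots q" "Arg2pi z = Arg2pi z'" for z z'
  proof (rule ccontr)
    assume "z \<noteq> z'"
    then obtain N where "proots q = add_mset z (add_mset z' N)"
      using z(1,2) by (metis insert_noteq_member multi_member_split)
    then have "count (root_angles q) (Arg2pi z) \<ge> 2"
      using z(3) by (simp add: root_angles_def)
    then show False using count_le[of "Arg2pi z"] by simp
  qed
  \<comment> \<open>The reflection \<open>1 / cnj z\<close> is a root and a positive real multiple
    of \<open>z\<close>, so it has the same angle. Distinctness of the angles forces
    \<open>z = 1 / cnj z\<close>, that is, norm one.\<close>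
  have on_circle: "cis (Arg2pi z) = z" if "z \<in># proots q" for z
  proof -
    have z: "poly q z = 0" using that \<open>q \<noteq> 0\<close> by simp
    \<comment> \<open>The constant coefficient is the conjugate of the leading one.\<close>
    have "coeff q 0 \<noteq> 0"
      using coeff[of 0] deg \<open>q \<noteq> 0\<close> by (metis complex_cnj_zero_iff diff_zero le0 leading_coeff_0_iff)
    then have "z \<noteq> 0" using z by (auto simp: poly_0_coeff_0)
    then have "poly q (1 / cnj z) = 0"
      using poly_reciprocal_cnj[OF eq_refl[OF deg] coeff \<open>z \<noteq> 0\<close>] z \<open>z \<noteq> 0\<close> by simp
    then have "1 / cnj z \<in># proots q" using \<open>q \<noteq> 0\<close> by simp
    moreover have "1 / cnj z = of_real (1 / (norm z)\<^sup>2) * z"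
      using \<open>z \<noteq> 0\<close> by (simp add: field_simps) (metis complex_norm_square of_real_power)
    then have "Arg2pi (1 / cnj z) = Arg2pi z"
      using \<open>z \<noteq> 0\<close> Arg2pi_times_of_real[of "1 / (norm z)\<^sup>2" z] by simp
    ultimately have "z = 1 / cnj z" using inj[OF that] by metis
    then have "z * cnj z = 1"
      using \<open>z \<noteq> 0\<close> by (metis complex_cnj_zero_iff nonzero_eq_divide_eq)
    then have "(norm z)\<^sup>2 = 1"
      by (simp only: complex_norm_square[symmetric] of_real_eq_1_iff)
    then have "norm z = 1"
      by (metis norm_ge_zero one_power2 power2_eq_imp_eq zero_le_one)
    then show ?thesis
      using Arg2pi_eq[of z] by (simp add: cis_conv_exp)
  qed
  define C where "C = lead_coeff q * (\<Prod>m<n. 2 * \<i> * cis (\<theta> m / 2))"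
  have factor: "poly q (cis t) = C * cis (t / 2) ^ n * of_real (\<Prod>m<n. sin ((t - \<theta> m) / 2))" for t
  proof -
    have "proots q = image_mset (\<lambda>z. cis (Arg2pi z)) (proots q)"
      using on_circle by (metis (no_types, lifting) image_mset_cong multiset.map_ident)
    also have "\<dots> = image_mset cis (root_angles q)"
      by (simp add: root_angles_def multiset.map_comp o_def)
    also have "\<dots> = image_mset (\<lambda>m. cis (\<theta> m)) (mset_set {..<n})"
      by (simp add: angles multiset.map_comp o_def atLeast0LessThan[symmetric])
    finally have pr: "proots q = image_mset (\<lambda>m. cis (\<theta> m)) (mset_set {..<n})" .
    have "poly q (cis t) = poly (smult (lead_coeff q) (\<Prod>x\<in>#proots q. [:-x, 1:])) (cis t)"
      by (simp only: complex_poly_decompose_multiset)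
    also have "(\<Prod>x\<in>#proots q. [:-x, 1:]) = (\<Prod>m<n. [:- cis (\<theta> m), 1:])"
      unfolding pr by (simp add: multiset.map_comp o_def prod_unfold_prod_mset)
    also have "poly (smult (lead_coeff q) \<dots>) (cis t) = lead_coeff q * (\<Prod>m<n. cis t - cis (\<theta> m))"
      by (simp add: poly_prod)
    also have "\<dots> = C * cis (t / 2) ^ n * of_real (\<Prod>m<n. sin ((t - \<theta> m) / 2))"
      unfolding cis_diff_eq C_def by (simp only: prod.distrib prod_constant card_lessThan of_real_prod mult.assoc)
    finally show ?thesis .
  qed
  \<comment> \<open>The sign is flipped for \<open>m \<ge> k\<close>, the root angles beyond the
    node, which makes every factor positive.\<close>
  define P where "P k = (\<Prod>m<n. (if m < k then 1 else - 1) * sin ((unity_angle n k - \<theta> m) / 2))" for k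
  have P_pos: "P k > 0" if "k < n" for k
    unfolding P_def
  proof (rule prod_pos)
    fix m assume "m \<in> {..<n}"
    then have m: "m < n" by simp
    note b = bounds[OF m] unity_angle_bounds[OF that]
    show "0 < (if m < k then 1 else - 1) * sin ((unity_angle n k - \<theta> m) / 2)"
    proof (cases "m < k")
      case True
      then have "\<theta> m < unity_angle n k"
        using upper[of m] node_mono[of "Suc m" k] that by linarith
      then have "sin ((unity_angle n k - \<theta> m) / 2) > 0"
        using b by (intro sin_half_diff_pos)
      then show ?thesis using True by simp
    next
      case False
      then have "unity_angle n k < \<theta> m"
        using lower[OF m] node_mono[of k m] by linarith
      then have "sin ((\<theta> m - unity_angle n k) / 2) > 0"
        using b by (intro sin_half_diff_pos)
      moreover have "sin ((\<theta> m - unity_angle n k) / 2) = - sin ((unity_angle n k - \<theta> m) / 2)"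
        by (metis minus_diff_eq minus_divide_left sin_minus)
      ultimately show ?thesis using False by simp
    qed
  qed
  \<comment> \<open>The \<open>n - k\<close> flips contribute \<open>(- 1) ^ (n + k)\<close>, and
    \<open>cis (t / 2) ^ n\<close> is \<open>(- 1) ^ k\<close> at the node. Together they leave
    \<open>(- 1) ^ n\<close>, so one constant serves all nodes.\<close>
  define D where "D = (- 1) ^ n * C"
  have val: "poly q (cis (unity_angle n k)) = D * of_real (P k)" if "k < n" for k
  proof -
    have "(\<Prod>m<n. if m < k then 1 else - 1 :: real) = (- 1) ^ card ({..<n} \<inter> - {m. m < k})"
      by (simp add: prod.If_cases)
    also have "{..<n} \<inter> - {m. m < k} = {k..<n}" by auto
    also have "(- 1 :: real) ^ card \<dots> = (- 1) ^ (n + k)"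
      using that by (simp add: minus_one_power_iff)
    finally have sign: "P k = (- 1) ^ (n + k) * (\<Prod>m<n. sin ((unity_angle n k - \<theta> m) / 2))"
      by (simp add: P_def prod.distrib)
    have "cis (unity_angle n k / 2) ^ n = (- 1) ^ k"
      using n by (simp add: Complex.DeMoivre flip: cis_pi_of_nat)
    then show ?thesis
      unfolding factor sign D_def by (simp add: power_add flip: power_mult_distrib mult.assoc)
  qed
  have node: "\<exists>r>0. Re (poly q \<omega>) = Re D * r" if "\<omega> \<in> unity_roots n" for \<omega>
    using that P_pos val unfolding unity_roots_eq[OF n] by fastforce
  have "Re D > 0"
  proof (rule ccontr)
    assume "\<not> Re D > 0"
    then have "(\<Sum>\<omega>\<in>unity_roots n. Re (poly q \<omega>)) \<le> 0"
      using node by (intro sum_nonpos) (fastforce simp: mult_le_0_iff)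
    then show False using sum_pos by linarith
  qed
  then show ?thesis using node[OF \<open>\<omega> \<in> unity_roots n\<close>] by auto
qed

section \<open>The interlace number as a maximum\<close>

text \<open>Only powers with exponent \<open>0 < j < n\<close> occur, and each of them sums to zero
  over the roots of unity.\<close>

lemma sum_poly_unity_roots:
  assumes n: "n > 0" and "degree p < n" "coeff p 0 = 0"
  shows "(\<Sum>\<omega>\<in>unity_roots n. poly p \<omega>) = 0"
proof -
  have inj: "inj_on (\<lambda>k. cis (unity_angle n k)) {..<n}"
    using Complex.bij_betw_roots_unity[OF n] by (simp add: bij_betw_def)
  have power_sum: "(\<Sum>k<n. cis (unity_angle n k) ^ j) = 0" if "0 < j" "j < n" for j
  proof -
    \<comment> \<open>Exchanging the roles of \<open>j\<close> and \<open>k\<close> gives a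
      geometric series whose ratio is an \<open>n\<close>-th root of unity other than
      \<open>1\<close>.\<close>
    have "(\<Sum>k<n. cis (unity_angle n k) ^ j) = (\<Sum>k<n. cis (unity_angle n j) ^ k)"
      by (intro sum.cong) (auto simp: Complex.DeMoivre mult_ac)
    moreover have "cis (unity_angle n j) ^ n = 1"
      using cis_unity_angle_mem[OF n] by (simp add: unity_roots_def)
    moreover have "cis (unity_angle n j) \<noteq> 1"
      using inj_onD[OF inj, of j 0] that by auto
    ultimately show ?thesis by (simp add: geometric_sum)
  qed
  have "(\<Sum>\<omega>\<in>unity_roots n. poly p \<omega>) = (\<Sum>k<n. \<Sum>j\<le>degree p. coeff p j * cis (unity_angle n k) ^ j)"
    unfolding unity_roots_eq[OF n] by (simp add: sum.reindex[OF inj] poly_altdef)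
  also have "\<dots> = (\<Sum>j\<le>degree p. coeff p j * (\<Sum>k<n. cis (unity_angle n k) ^ j))"
    by (subst sum.swap) (simp add: sum_distrib_left)
  also have "\<dots> = 0"
  proof (rule sum.neutral, rule ballI)
    fix j assume "j \<in> {..degree p}"
    then show "coeff p j * (\<Sum>k<n. cis (unity_angle n k) ^ j) = 0"
      using power_sum[of j] assms by (cases "j = 0") auto
  qed
  finally show ?thesis .
qed

lemma INF_ereal_greaterThan: "(INF \<alpha>\<in>{c<..}. ereal \<alpha>) = ereal c"
proof (rule INF_eqI)
  fix y assume y: "\<And>i. i \<in> {c<..} \<Longrightarrow> y \<le> ereal i"
  show "y \<le> ereal c"
  proof (rule ccontr)
    assume "\<not> y \<le> ereal c"
    then obtain z where "ereal c < ereal z" "ereal z < y" using ereal_dense2 by (meson not_le)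
    then show False using y[of z] by auto
  qed
qed auto

text \<open>The gap \<open>darga p - degree p\<close> is the least index of a nonzero coefficient,
  which is positive when the constant term vanishes. The strict bound makes \<open>\<alpha>\<close>
  the leading coefficient of \<open>p_alpha\<close>.\<close>

lemma trim_self_inversive_degree:
  assumes "p \<noteq> 0" "trim p"
  shows "coeff p 0 = 0" "degree p < darga p"
proof -
  show c0: "coeff p 0 = 0" using \<open>trim p\<close> by (simp add: trim_def poly_0_coeff_0)
  have "coeff p (LEAST r. coeff p r \<noteq> 0) \<noteq> 0"
    using \<open>p \<noteq> 0\<close> by (intro LeastI[of "\<lambda>r. coeff p r \<noteq> 0" "degree p"]) simp
  with c0 have "(LEAST r. coeff p r \<noteq> 0) \<noteq> 0" by metis
  then show "degree p < darga p" by (simp add: darga_def)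
qed

lemma strictly_angle_interlaces_p_alpha_iff:
  assumes "p \<noteq> 0" "darga p = n" "self_inversive p" "trim p" "\<alpha> > 0"
  shows "strictly_angle_interlaces (p_alpha n p \<alpha>) n \<longleftrightarrow>
           (\<forall>\<omega>\<in>unity_roots n. 2 * \<alpha> + Re (poly p \<omega>) > 0)"
proof -
  let ?q = "p_alpha n p \<alpha>"
  note p = trim_self_inversive_degree[OF assms(1,4), unfolded assms(2)]
  have n: "n > 0" using p(2) by simp
  have "coeff p n = 0" using p(2) by (simp add: coeff_eq_0)
  then have coeff_n: "coeff ?q n = of_real \<alpha>" using n by (simp add: p_alpha_def)
  have "degree ?q = n"
  proof (rule antisym)
    show "degree ?q \<le> n"
      unfolding p_alpha_def using p(2)
      by (intro degree_add_le order.trans[OF degree_smult_le] degree_monom_le) auto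
    show "n \<le> degree ?q" using coeff_n \<open>\<alpha> > 0\<close> by (intro le_degree) simp
  qed
  have coeff: "coeff ?q j = cnj (coeff ?q (n - j))" if "j \<le> n" for j
  proof -
    have "coeff p j = cnj (coeff p (n - j))"
      using assms(2,3) that unfolding self_inversive_def by blast
    then show ?thesis using that n by (auto simp: p_alpha_def coeff_1)
  qed
  have val: "Re (poly ?q \<omega>) = 2 * \<alpha> + Re (poly p \<omega>)" if "\<omega> \<in> unity_roots n" for \<omega>
    using that by (simp add: p_alpha_def poly_monom unity_roots_def)
  \<comment> \<open>On the roots of unity \<open>x ^ n + 1\<close> is \<open>2\<close>, and the
    values of \<open>p\<close> cancel in the sum, so \<open>\<alpha> > 0\<close> makes the total
    positive.\<close>
  have "(\<Sum>\<omega>\<in>unity_roots n. Re (poly ?q \<omega>)) = 2 * \<alpha> * real (card (unity_roots n))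
          + Re (\<Sum>\<omega>\<in>unity_roots n. poly p \<omega>)"
    by (simp add: val sum.distrib)
  also have "\<dots> > 0"
    using sum_poly_unity_roots[OF n p(2,1)] \<open>\<alpha> > 0\<close> n card_roots_unity_eq[OF n]
    by (simp add: unity_roots_def)
  finally show ?thesis
    using interlaces_if_positive_on_unity_roots[OF n \<open>degree ?q = n\<close> coeff]
      positive_on_unity_roots_if_interlaces[OF n coeff] val by metis
qed

lemma interlace_number_eq:
  assumes "p \<noteq> 0" "darga p = n" "self_inversive p" "trim p"
  shows "interlace_number p = ereal (1 / 2 * Max ((\<lambda>\<omega>. - Re (poly p \<omega>)) ` unity_roots n))"
proof -
  let ?M = "Max ((\<lambda>\<omega>. - Re (poly p \<omega>)) ` unity_roots n)"
  note p = trim_self_inversive_degree[OF assms(1,4), unfolded assms(2)]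
  have n: "n > 0" using p(2) by simp
  have fin: "finite (unity_roots n)" and ne: "unity_roots n \<noteq> {}"
    unfolding unity_roots_eq[OF n] using n by auto
  have less_iff: "?M < x \<longleftrightarrow> (\<forall>\<omega>\<in>unity_roots n. - Re (poly p \<omega>) < x)" for x
    using fin ne by (subst Max_less_iff) auto
  \<comment> \<open>The values of \<open>p\<close> sum to zero, so they cannot all be positive.
    Hence \<open>\<alpha> > 0\<close> follows from \<open>?M / 2 < \<alpha>\<close>, and the
    admissible set is an open ray.\<close>
  have "?M \<ge> 0"
  proof (rule ccontr)
    assume "\<not> ?M \<ge> 0"
    then have "\<forall>\<omega>\<in>unity_roots n. Re (poly p \<omega>) > 0" using less_iff[of 0] by simp
    then have "(\<Sum>\<omega>\<in>unity_roots n. Re (poly p \<omega>)) > 0"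
      using fin ne by (intro sum_pos) auto
    then show False
      using arg_cong[OF sum_poly_unity_roots[OF n p(2,1)], of Re] by simp
  qed
  have "{\<alpha>. 0 < \<alpha> \<and> strictly_angle_interlaces (p_alpha (darga p) p \<alpha>) (darga p)} = {1 / 2 * ?M<..}"
  proof (intro set_eqI)
    fix \<alpha>
    have "\<alpha> > 0 \<and> strictly_angle_interlaces (p_alpha n p \<alpha>) n \<longleftrightarrow> \<alpha> > 0 \<and> ?M < 2 * \<alpha>"
      using strictly_angle_interlaces_p_alpha_iff[OF assms, of \<alpha>] less_iff[of "2 * \<alpha>"]
      by (metis (no_types, lifting) add.commute diff_less_eq diff_0 minus_less_iff neg_less_0_iff_less less_diff_eq uminus_add_conv_diff)
    then show "\<alpha> \<in> {\<alpha>. 0 < \<alpha> \<and> strictly_angle_interlaces (p_alpha (darga p) p \<alpha>) (darga p)}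
        \<longleftrightarrow> \<alpha> \<in> {1 / 2 * ?M<..}"
      using \<open>?M \<ge> 0\<close> assms(2) by auto
  qed
  then show ?thesis
    unfolding interlace_number_def by (simp only: INF_ereal_greaterThan)
qed

section \<open>Evaluation in the real coefficients\<close>

text \<open>Conjugates are enumerated for the sign of the sine: if \<open>z = cis (- t)\<close> and
  \<open>z ^ n = 1\<close>, then \<open>\<i> * (z ^ k - z ^ (n - k))\<close> is
  \<open>2 * sin (k * t)\<close>, while \<open>z = cis t\<close> would give its negative.\<close>

lemma unity_roots_eq_cnj:
  assumes "n > 0"
  shows "unity_roots n = (\<lambda>j. cis (- unity_angle n j)) ` {0..<n}"
proof -
  have "unity_roots n = cnj ` unity_roots n"
    by (force simp: unity_roots_def image_iff simp flip: complex_cnj_power intro: exI[of _ "cnj _"])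
  then show ?thesis
    unfolding unity_roots_eq[OF assms] by (simp add: image_image cis_cnj atLeast0LessThan)
qed

theorem mainTheorem5:
  fixes p :: "complex poly" and n :: nat and \<sigma> p_hat :: "nat \<Rightarrow> real"
  assumes "p \<noteq> 0" and "darga p = n" and "self_inversive p" and "trim p"
    and "p = (\<Sum>j = 1..n div 2. smult (complex_of_real (\<sigma> j)) (monom 1 j + monom 1 (n - j)))
           + smult \<i> (\<Sum>j = 1..(n - 1) div 2.
               smult (complex_of_real (p_hat j)) (monom 1 j - monom 1 (n - j)))"
  shows "(\<forall>\<omega> \<in> unity_roots n. poly p \<omega> \<in> \<real>) \<and>
    interlace_number p = ereal (1 / 2 * Max ((\<lambda>\<omega>. - Re (poly p \<omega>)) ` unity_roots n)) \<and>
    interlace_number p = ereal (Max ((\<lambda>j::nat.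
        - ((\<Sum>k = 1..n div 2. cos (2 * pi * real j * real k / real n) * \<sigma> k)
         + (\<Sum>k = 1..(n - 1) div 2. sin (2 * pi * real j * real k / real n) * p_hat k)))
       ` {0..<n}))"
proof -
  have n: "n > 0"
    using trim_self_inversive_degree(2)[OF assms(1,4)] assms(2) by simp
  define F where "F j = (\<Sum>k = 1..n div 2. cos (2 * pi * real j * real k / real n) * \<sigma> k)
         + (\<Sum>k = 1..(n - 1) div 2. sin (2 * pi * real j * real k / real n) * p_hat k)" for j :: nat
  have val: "poly p (cis (- unity_angle n j)) = of_real (2 * F j)" for j
  proof -
    let ?z = "cis (- unity_angle n j)"
    have pow: "?z ^ k = cis (- (2 * pi * real j * real k / real n))" for k
      by (simp add: Complex.DeMoivre mult_ac)
    \<comment> \<open>This turns the exponent \<open>n - k\<close> into \<open>- k\<close>, so the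
      paired monomials collapse to twice a cosine or a sine.\<close>
    have "?z ^ n = 1"
      using arg_cong[OF cis_unity_angle_mem[OF n, of j, unfolded unity_roots_def mem_Collect_eq], of cnj]
      by (simp add: cis_cnj)
    then have "?z ^ (n - k) = inverse (?z ^ k)" if "k \<le> n" for k
      using that by (simp add: power_diff field_simps)
    then have pow': "?z ^ (n - k) = cis (2 * pi * real j * real k / real n)" if "k \<le> n" for k
      using that by (simp add: pow)
    have plus: "?z ^ k + ?z ^ (n - k) = of_real (2 * cos (2 * pi * real j * real k / real n))"
      and minus: "\<i> * (?z ^ k - ?z ^ (n - k)) = of_real (2 * sin (2 * pi * real j * real k / real n))"
      if "k \<le> n" for k
      unfolding pow'[OF that] pow[of k] by (simp_all add: complex_eq_iff)
    have "poly p ?z = (\<Sum>k = 1..n div 2. of_real (\<sigma> k) * (?z ^ k + ?z ^ (n - k)))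
        + (\<Sum>k = 1..(n - 1) div 2. of_real (p_hat k) * (\<i> * (?z ^ k - ?z ^ (n - k))))"
      by (subst assms(5)) (simp add: poly_sum poly_monom sum_distrib_left mult_ac)
    also have "\<dots> = (\<Sum>k = 1..n div 2. of_real (2 * (cos (2 * pi * real j * real k / real n) * \<sigma> k)))
        + (\<Sum>k = 1..(n - 1) div 2. of_real (2 * (sin (2 * pi * real j * real k / real n) * p_hat k)))"
      by (intro arg_cong2[of _ _ _ _ "(+)"] sum.cong refl; subst plus minus) auto
    also have "\<dots> = of_real (2 * F j)"
      by (simp only: F_def distrib_left sum_distrib_left of_real_add of_real_sum)
    finally show ?thesis .
  qed
  have real: "\<forall>\<omega>\<in>unity_roots n. poly p \<omega> \<in> \<real>"
    unfolding unity_roots_eq_cnj[OF n] using val by auto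
  have "(\<lambda>\<omega>. - Re (poly p \<omega>)) ` unity_roots n = (\<lambda>x. 2 * x) ` (\<lambda>j. - F j) ` {0..<n}"
    unfolding unity_roots_eq_cnj[OF n] image_image val by simp
  \<comment> \<open>The common factor \<open>2\<close> leaves the maximum by monotonicity and then
    cancels the \<open>1 / 2\<close>.\<close>
  moreover have "Max ((\<lambda>x. 2 * x) ` (\<lambda>j. - F j) ` {0..<n}) = 2 * Max ((\<lambda>j. - F j) ` {0..<n})"
    using n by (intro mono_Max_commute[symmetric]) (auto simp: mono_def)
  ultimately have "1 / 2 * Max ((\<lambda>\<omega>. - Re (poly p \<omega>)) ` unity_roots n) = Max ((\<lambda>j. - F j) ` {0..<n})"
    by simp
  then show ?thesis
    using real interlace_number_eq[OF assms(1-4)] unfolding F_def by simp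
qed

end
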